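(* Let $\mathscr{A}$ be an arithmetic variety and let $F$ be a positive integer. Then $\mathscr{A}_F:=\{S\in\mathscr{A}\mid \operatorname{F}(S)\le F\}$ is a finite arithmetic variety.
   Context: $\mathbb{N}$ denotes the set of non-negative integers. A numerical semigroup is a subset $S\subseteq\mathbb{N}$ containing $0$, closed under addition, with $\mathbb{N}\setminus S$ finite. Its Frobenius number is $\operatorname{F}(S)=\max(\mathbb{Z}\setminus S)$ (so $\operatorname{F}(\mathbb{N})=-1$). For numerical semigroups $S,T$, $T$ is an arithmetic extension of $S$ if there exist positive integers $d_1,\dots,d_n$ ($n\ge 1$) such that $T=\{x\in\mathbb{N}\mid \{d_1x,\dots,d_nx\}\subset S\}$. An arithmetic variety is a non-empty family $\mathscr{A}$ of numerical semigroups such that (a) if $S,T\in\mathscr{A}$ then $S\cap T\in\mathscr{A}$; (b) if $S\in\mathscr{A}$ and $T$ is an arithmetic extension of $S$, then $T\in\mathscr{A}$. It is called a finite arithmetic variety when $\mathscr{A}$ has finite cardinality. *)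

theory Defs
  imports Main
begin

definition numerical_semigroup :: "nat set \<Rightarrow> bool" where
  "numerical_semigroup S \<longleftrightarrow>
     0 \<in> S \<and> (\<forall>x\<in>S. \<forall>y\<in>S. x + y \<in> S) \<and> finite (UNIV - S)"

text \<open>The maximum is taken in the integers, so that the value at \<open>UNIV\<close> is -1.
  It exists for every numerical semigroup; since the set of integers outside \<open>S\<close> is
  infinite, it is not an instance of \<open>Max\<close>.\<close>

definition Frobenius :: "nat set \<Rightarrow> int" where
  "Frobenius S = (GREATEST z. z \<notin> int ` S)"

definition arithmetic_extension :: "nat set \<Rightarrow> nat set \<Rightarrow> bool" where
  "arithmetic_extension T S \<longleftrightarrow>
     numerical_semigroup S \<and> numerical_semigroup T \<and>
     (\<exists>(n::nat) (d::nat \<Rightarrow> nat). n \<ge> 1 \<and> (\<forall>i\<in>{1..n}. d i > 0) \<and>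
        T = {x. (\<lambda>i. d i * x) ` {1..n} \<subseteq> S})"

definition arithmetic_variety :: "nat set set \<Rightarrow> bool" where
  "arithmetic_variety \<A> \<longleftrightarrow>
     \<A> \<noteq> {} \<and> (\<forall>S\<in>\<A>. numerical_semigroup S) \<and>
     (\<forall>S\<in>\<A>. \<forall>T\<in>\<A>. S \<inter> T \<in> \<A>) \<and>
     (\<forall>S\<in>\<A>. \<forall>T. arithmetic_extension T S \<longrightarrow> T \<in> \<A>)"

definition finite_arithmetic_variety :: "nat set set \<Rightarrow> bool" where
  "finite_arithmetic_variety \<A> \<longleftrightarrow> arithmetic_variety \<A> \<and> finite \<A>"

end

theory Submission
  imports Defs
begin

text \<open>For a bound \<open>F \<ge> -1\<close>, the inequality \<open>Frobenius S \<le> F\<close> says exactly that every gap of \<open>S\<close>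
  is at most \<open>F\<close> (lemma \<open>Frobenius_le_iff\<close>). Both closure properties of a variety respect this
  condition: a gap of \<open>S \<inter> T\<close> is a gap of \<open>S\<close> or of \<open>T\<close>, and if \<open>x\<close> is a gap of an arithmetic
  extension of \<open>S\<close>, then some multiple \<open>d * x \<ge> x\<close> is a gap of \<open>S\<close>. The subfamily is non-empty
  because every variety contains \<open>\<nat>\<close>, whose Frobenius number is \<open>-1\<close>: all multiples of a positive
  element of \<open>S\<close> lie in \<open>S\<close>, so dividing by that element extends \<open>S\<close> to \<open>\<nat>\<close>. The subfamily is
  finite because a semigroup is determined by its gaps, here a subset of \<open>{0..F}\<close>.\<close>

text \<open>All negative integers lie outside \<open>S\<close>, so the greatest integer outside \<open>S\<close> is already the
  maximum of the finite set consisting of \<open>-1\<close> and the gaps.\<close>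

lemma Frobenius_eq_Max:
  assumes "numerical_semigroup S"
  shows "Frobenius S = Max (insert (-1) (int ` (UNIV - S)))"
  unfolding Frobenius_def
proof (rule Greatest_equality)
  let ?G = "insert (-1) (int ` (UNIV - S))"
  have fin: "finite ?G"
    using assms by (simp add: numerical_semigroup_def)
  have "Max ?G \<in> ?G"
    using fin by (intro Max_in) auto
  then show "Max ?G \<notin> int ` S"
    by auto
  fix z assume z: "z \<notin> int ` S"
  show "z \<le> Max ?G"
  proof (cases "z \<ge> 0")
    case True
    then obtain n where "z = int n"
      using nonneg_int_cases by blast
    with z have "z \<in> ?G"
      by auto
    with fin show ?thesis
      by (rule Max_ge)
  next
    case False
    moreover have "-1 \<le> Max ?G"
      using fin by (intro Max_ge) auto
    ultimately show ?thesis
      by linarith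
  qed
qed

lemma Frobenius_le_iff:
  assumes "numerical_semigroup S" and "F \<ge> -1"
  shows "Frobenius S \<le> F \<longleftrightarrow> (\<forall>x. x \<notin> S \<longrightarrow> int x \<le> F)"
  using assms by (auto simp: Frobenius_eq_Max numerical_semigroup_def)

lemma numerical_semigroup_mult:
  assumes "numerical_semigroup S" and "d \<in> S"
  shows "d * x \<in> S"
  using assms by (induction x) (auto simp: numerical_semigroup_def)

lemma arithmetic_extension_UNIV:
  assumes S: "numerical_semigroup S"
  shows "arithmetic_extension UNIV S"
proof -
  have "finite (UNIV - S)"
    using S by (simp add: numerical_semigroup_def)
  then have "finite (insert 0 (UNIV - S))"
    by simp
  then obtain d where "d \<notin> insert 0 (UNIV - S)"
    using ex_new_if_finite infinite_UNIV_nat by blast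
  then have "d > 0" and "d \<in> S"
    by auto
  then have "UNIV = {x. (\<lambda>i. d * x) ` {1..1::nat} \<subseteq> S}"
    using numerical_semigroup_mult[OF S] by auto
  moreover have "numerical_semigroup UNIV"
    by (simp add: numerical_semigroup_def)
  ultimately show ?thesis
    unfolding arithmetic_extension_def using S \<open>d > 0\<close>
    by (intro conjI exI[of _ 1] exI[of _ "\<lambda>_. d"]) auto
qed

lemma arithmetic_extension_gap:
  assumes "arithmetic_extension T S" and "x \<notin> T"
  obtains y where "y \<notin> S" and "x \<le> y"
proof -
  from assms obtain n :: nat and d :: "nat \<Rightarrow> nat"
    where "\<forall>i\<in>{1..n}. d i > 0" and "T = {x. (\<lambda>i. d i * x) ` {1..n} \<subseteq> S}"
    unfolding arithmetic_extension_def by blast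
  with \<open>x \<notin> T\<close> obtain i where "d i > 0" and "d i * x \<notin> S"
    by auto
  then show thesis
    using that[of "d i * x"] by simp
qed

lemma finite_gaps_bounded: "finite {S. \<forall>x::nat. x \<notin> S \<longrightarrow> int x \<le> F}"
proof (rule finite_subset)
  show "{S. \<forall>x::nat. x \<notin> S \<longrightarrow> int x \<le> F} \<subseteq> uminus ` Pow {..nat F}"
  proof
    fix S :: "nat set"
    assume "S \<in> {S. \<forall>x::nat. x \<notin> S \<longrightarrow> int x \<le> F}"
    then have "- S \<in> Pow {..nat F}"
      by force
    then show "S \<in> uminus ` Pow {..nat F}"
      by (metis double_complement image_eqI)
  qed
qed simp

theorem proposition28:
  fixes \<A> :: "nat set set" and F :: int
  assumes "arithmetic_variety \<A>"
    and "F > 0"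
  shows "finite_arithmetic_variety {S \<in> \<A>. Frobenius S \<le> F}"
proof -
  have sg: "numerical_semigroup S" if "S \<in> \<A>" for S
    using assms(1) that by (simp add: arithmetic_variety_def)
  have ext: "T \<in> \<A>" if "S \<in> \<A>" "arithmetic_extension T S" for S T
    using assms(1) that unfolding arithmetic_variety_def by blast
  have inter: "S \<inter> T \<in> \<A>" if "S \<in> \<A>" "T \<in> \<A>" for S T
    using assms(1) that by (simp add: arithmetic_variety_def)
  define \<B> where "\<B> = {S \<in> \<A>. \<forall>x. x \<notin> S \<longrightarrow> int x \<le> F}"
  have eq: "{S \<in> \<A>. Frobenius S \<le> F} = \<B>"
    using Frobenius_le_iff sg assms(2) unfolding \<B>_def by auto
  obtain S where "S \<in> \<A>"
    using assms(1) unfolding arithmetic_variety_def by blast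
  then have "UNIV \<in> \<B>"
    using ext arithmetic_extension_UNIV sg by (auto simp: \<B>_def)
  moreover have "S \<inter> T \<in> \<B>" if "S \<in> \<B>" "T \<in> \<B>" for S T
    using that inter by (auto simp: \<B>_def)
  moreover have "T \<in> \<B>" if "S \<in> \<B>" "arithmetic_extension T S" for S T
  proof -
    have "int x \<le> F" if "x \<notin> T" for x
    proof -
      obtain y where "y \<notin> S" "x \<le> y"
        using arithmetic_extension_gap \<open>arithmetic_extension T S\<close> \<open>x \<notin> T\<close> by blast
      moreover from this have "int y \<le> F"
        using \<open>S \<in> \<B>\<close> by (simp add: \<B>_def)
      ultimately show ?thesis
        by linarith
    qed
    moreover have "T \<in> \<A>"
      using that ext[of S T] by (simp add: \<B>_def)
    ultimately show ?thesis
      by (simp add: \<B>_def)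
  qed
  moreover have "numerical_semigroup S" if "S \<in> \<B>" for S
    using that sg by (simp add: \<B>_def)
  ultimately have "arithmetic_variety \<B>"
    unfolding arithmetic_variety_def by blast
  moreover have "finite \<B>"
    using finite_gaps_bounded[of F] by (rule rev_finite_subset) (auto simp: \<B>_def)
  ultimately show ?thesis
    unfolding eq finite_arithmetic_variety_def by simp
qed

end
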